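(* Let $d\ge1$ and let $\boldsymbol\tau^{0:K}:(0,1)^d\to\mathbb{R}^d$ be the Euler-discretized diffusion transport map (defined in the context) with vector field $\boldsymbol v_\theta$ on $\mathbb{R}^d\times[0,T]$ and $K$ Euler steps. Assume that for every multi-index $\beta\in\mathbb{N}_0^d$ with $0\le|\beta|\le d+1$ there is $M_\beta<\infty$ such that for all $j\in\{1,\dots,d\}$, $\sup_{\mathbf x\in\mathbb{R}^d,\,t\in[0,T]}|\partial_{\mathbf x}^\beta v_{\theta,j}(\mathbf x,t)|\le M_\beta$. Then there exist constants $B_0>0$ and $C_4>0$ such that for all $\mathbf u\in(0,1)^d$ and all $k\in\{1,\dots,d\}$, $$\min\bigl(\Phi(\tau^{0:K}(\mathbf u)_k),\,1-\Phi(\tau^{0:K}(\mathbf u)_k)\bigr)^{-1}\le C_4\prod_{\ell=1}^d\min(u_\ell,1-u_\ell)^{-B_0}.$$ Moreover, there exist $C_5>0$ and $C'\in\mathbb{R}$ such that for all $\mathbf u\in(0,1)^d$ and all $k\in\{1,\dots,d\}$, $$|\tau^{0:K}(\mathbf u)_k|^2\ge C_5\,|\ln(\min(u_k,1-u_k))|-C'.$$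
   Context: $\Phi$ is the standard normal CDF on $\mathbb{R}$. Diffusion transport map: let $T>0$, let $K\ge1$ be the number of Euler steps, $\eta=T/K$ the step size, and $t_k=T-k\eta$ for $k=0,\dots,K$. The vector field is $\boldsymbol v_\theta:\mathbb{R}^d\times[0,T]\to\mathbb{R}^d$, $\boldsymbol v_\theta(\mathbf x,t)=\mathbf f(\mathbf x,t)-\frac12 g(t)^2\mathbf s_\theta(\mathbf x,t)$, where $\mathbf f$ and $g$ are the drift and diffusion coefficients of a diffusion $d\mathbf x=\mathbf f(\mathbf x,t)\,dt+g(t)\,d\mathbf w$ and $\mathbf s_\theta$ is a (learned) score function; its components are $v_{\theta,j}$. Let $G(\mathbf u)=(\Phi^{-1}(u_1),\dots,\Phi^{-1}(u_d))$ for $\mathbf u\in(0,1)^d$. The Euler step maps are $\boldsymbol\tau^k(\mathbf x)=\mathbf x-\eta\,\boldsymbol v_\theta(\mathbf x,t_k)$, $k=0,\dots,K-1$, and $\boldsymbol\tau^{0:K}=\boldsymbol\tau^{K-1}\circ\cdots\circ\boldsymbol\tau^0\circ G$; $\tau^{0:K}(\mathbf u)_k$ denotes its $k$-th component. *)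

theory Defs
  imports "HOL-Probability.Probability"
begin

definition std_normal_cdf :: "real \<Rightarrow> real" where
  "std_normal_cdf = cdf std_normal_distribution"

definition normal_quantile_map :: "real ^ 'n \<Rightarrow> real ^ 'n" where
  "normal_quantile_map u = (\<chi> i. inv std_normal_cdf (u $ i))"

text \<open>
  Multi-index partial derivatives: \<open>mixed_partial F \<beta> H\<close> says that \<open>H\<close> is obtained from \<open>F\<close> by
  successive partial differentiations, \<open>\<beta> i\<close> of them in coordinate \<open>i\<close>, each of which exists on
  all of space. Some order of the differentiations suffices; for a function of class
  \<open>C^|\<beta>|\<close> the order is immaterial and \<open>H\<close> is the usual derivative of multi-index \<open>\<beta>\<close>. A relation
  is used since the value of \<open>deriv\<close> is unspecified where the derivative does not exist.
\<close>

inductive mixed_partial ::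
    "(real ^ 'n::finite \<Rightarrow> real) \<Rightarrow> ('n \<Rightarrow> nat) \<Rightarrow> (real ^ 'n \<Rightarrow> real) \<Rightarrow> bool"
  for F :: "real ^ 'n \<Rightarrow> real" where
  zero: "mixed_partial F (\<lambda>_. 0) F"
| step: "mixed_partial F \<beta> H \<Longrightarrow>
    (\<And>x. ((\<lambda>h. H (x + h *\<^sub>R axis i 1)) has_real_derivative H' x) (at 0)) \<Longrightarrow>
    mixed_partial F (\<beta>(i := Suc (\<beta> i))) H'"

definition diffusion_field ::
    "(real ^ 'n \<Rightarrow> real \<Rightarrow> real ^ 'n) \<Rightarrow> (real \<Rightarrow> real) \<Rightarrow> (real ^ 'n \<Rightarrow> real \<Rightarrow> real ^ 'n) \<Rightarrow>
     real ^ 'n \<Rightarrow> real \<Rightarrow> real ^ 'n" where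
  "diffusion_field f g s x t = f x t - ((1 / 2) * (g t)\<^sup>2) *\<^sub>R s x t"

definition euler_step ::
    "(real ^ 'n \<Rightarrow> real \<Rightarrow> real ^ 'n) \<Rightarrow> real \<Rightarrow> nat \<Rightarrow> nat \<Rightarrow> real ^ 'n \<Rightarrow> real ^ 'n" where
  "euler_step v T K k x = (let \<eta> = T / real K in x - \<eta> *\<^sub>R v x (T - real k * \<eta>))"

text \<open>\<open>euler_flow v T K n\<close> is the composition of the steps \<open>n - 1, \<dots>, 0\<close>, step \<open>0\<close> (at time \<open>T\<close>)
  being applied first.\<close>

primrec euler_flow ::
    "(real ^ 'n \<Rightarrow> real \<Rightarrow> real ^ 'n) \<Rightarrow> real \<Rightarrow> nat \<Rightarrow> nat \<Rightarrow> real ^ 'n \<Rightarrow> real ^ 'n" where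
  "euler_flow v T K 0 = id"
| "euler_flow v T K (Suc n) = euler_step v T K n \<circ> euler_flow v T K n"

definition euler_transport ::
    "(real ^ 'n \<Rightarrow> real \<Rightarrow> real ^ 'n) \<Rightarrow> real \<Rightarrow> nat \<Rightarrow> real ^ 'n \<Rightarrow> real ^ 'n" where
  "euler_transport v T K = euler_flow v T K K \<circ> normal_quantile_map"

end

(* The field is bounded (multi-index zero), so the K Euler steps move each coordinate of the
   Gaussian quantile z by at most a constant D. The smaller normal tail at x, written m x below, lies
   between c exp (-x^2) and exp (-x^2/2), so a bounded displacement only costs a constant
   and a fixed power of m: with |y - z| <= D one has y^2 <= 2 z^2 + 2 D^2, hence
   m y >= c exp (-2 D^2) (m z)^4, and z^2 <= 2 y^2 + 2 D^2, hence
   |ln (m z)| <= 2 y^2 + 2 D^2 - ln c. *)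

theory Submission imports Defs begin

section \<open>Tails of the standard normal distribution\<close>

text \<open>Complete the square: \<open>t^2 = x^2 + (t - x)^2 + 2 * x * (t - x)\<close>. The sign
  condition then puts the standard density on \<open>A\<close> below \<open>exp (- x^2 / 2)\<close>
  times the normal density with mean \<open>x\<close>, whose total mass is 1.\<close>

lemma std_normal_measure_le:
  assumes [measurable]: "A \<in> sets borel" and A: "\<And>t. t \<in> A \<Longrightarrow> 0 \<le> x * (t - x)"
  shows "measure std_normal_distribution A \<le> exp (- x\<^sup>2 / 2)"
proof -
  have shift: "std_normal_density t \<le> exp (- x\<^sup>2 / 2) * normal_density x 1 t" if "t \<in> A" for t
  proof -
    have "t\<^sup>2 = x\<^sup>2 + (t - x)\<^sup>2 + 2 * (x * (t - x))"
      by (simp add: power2_eq_square algebra_simps)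
    then have "- t\<^sup>2 / 2 \<le> - x\<^sup>2 / 2 + - (t - x)\<^sup>2 / 2"
      using A[OF that] by simp
    then have "exp (- t\<^sup>2 / 2) \<le> exp (- x\<^sup>2 / 2) * exp (- (t - x)\<^sup>2 / 2)"
      by (simp add: exp_add[symmetric])
    then show ?thesis
      by (simp add: normal_density_def divide_right_mono)
  qed
  interpret N: prob_space "density lborel (normal_density x 1)"
    by (rule prob_space_normal_density) simp
  have one: "(\<integral>\<^sup>+t. ennreal (normal_density x 1 t) \<partial>lborel) = 1"
    using N.emeasure_space_1 by (simp add: emeasure_density)
  have "emeasure std_normal_distribution A
      = (\<integral>\<^sup>+t. ennreal (std_normal_density t) * indicator A t \<partial>lborel)"
    by (simp add: emeasure_density)
  also have "\<dots> \<le> (\<integral>\<^sup>+t. ennreal (exp (- x\<^sup>2 / 2)) * ennreal (normal_density x 1 t) \<partial>lborel)"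
    by (intro nn_integral_mono)
      (use shift in \<open>auto split: split_indicator simp: ennreal_mult[symmetric] intro!: ennreal_leI\<close>)
  also have "\<dots> = ennreal (exp (- x\<^sup>2 / 2))"
    by (simp add: nn_integral_cmult one)
  finally show ?thesis
    by (simp add: measure_def enn2real_leI)
qed

text \<open>On the unit interval inside \<open>A\<close> every \<open>t\<close> is within 1 of
  \<open>x\<close>, so \<open>t^2 \<le> 2 * x^2 + 2\<close> bounds the density from below. The free
  endpoint \<open>a\<close> lets one statement serve both tails.\<close>

lemma std_normal_measure_ge:
  assumes [measurable]: "A \<in> sets borel" and A: "{a<..<a+1} \<subseteq> A"
    and x: "x - 1 \<le> a" "a \<le> x"
  shows "exp (- 1) / sqrt (2 * pi) * exp (- x\<^sup>2) \<le> measure std_normal_distribution A"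
proof -
  let ?c = "exp (- 1) / sqrt (2 * pi) * exp (- x\<^sup>2)"
  interpret real_distribution std_normal_distribution
    by (rule real_dist_normal_dist)
  have low: "?c \<le> std_normal_density t" if "t \<in> {a<..<a+1}" for t
  proof -
    have "\<bar>t - x\<bar> \<le> 1" using that x by auto
    then have "(t - x)\<^sup>2 \<le> 1" by (simp add: abs_square_le_1)
    moreover have "2 * x\<^sup>2 + 2 * (t - x)\<^sup>2 - t\<^sup>2 = (2 * x - t)\<^sup>2"
      by (simp add: power2_eq_square algebra_simps)
    then have "t\<^sup>2 \<le> 2 * x\<^sup>2 + 2 * (t - x)\<^sup>2"
      by (metis diff_ge_0_iff_ge zero_le_power2)
    ultimately have "- 1 + - x\<^sup>2 \<le> - t\<^sup>2 / 2" by simp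
    then have "exp (- 1) * exp (- x\<^sup>2) \<le> exp (- t\<^sup>2 / 2)"
      by (simp add: exp_add[symmetric])
    then show ?thesis
      by (simp add: std_normal_density_def divide_right_mono)
  qed
  have "ennreal ?c = (\<integral>\<^sup>+t. ennreal ?c * indicator {a<..<a+1} t \<partial>lborel)"
    by (simp add: nn_integral_cmult_indicator)
  also have "\<dots> \<le> (\<integral>\<^sup>+t. ennreal (std_normal_density t) * indicator A t \<partial>lborel)"
    using A low by (intro nn_integral_mono)
      (auto split: split_indicator intro!: ennreal_leI)
  also have "\<dots> = emeasure std_normal_distribution A"
    by (simp add: emeasure_density)
  finally show ?thesis
    by (simp add: emeasure_eq_measure)
qed

definition normal_min_tail :: "real \<Rightarrow> real" where
  "normal_min_tail x = min (std_normal_cdf x) (1 - std_normal_cdf x)"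

lemma std_normal_cdf_complement:
  "1 - std_normal_cdf x = measure std_normal_distribution {x<..}"
proof -
  interpret real_distribution std_normal_distribution
    by (rule real_dist_normal_dist)
  have "{x<..} = space std_normal_distribution - {..x}" by auto
  then show ?thesis
    by (simp only: std_normal_cdf_def cdf_def2) (subst prob_compl; simp)
qed

text \<open>Bounding one tail suffices: the one pointing away from the origin meets the sign
  condition of \<open>std_normal_measure_le\<close>.\<close>

lemma normal_min_tail_le: "normal_min_tail x \<le> exp (- x\<^sup>2 / 2)"
proof (cases "x \<le> 0")
  case True
  then have "std_normal_cdf x \<le> exp (- x\<^sup>2 / 2)"
    unfolding std_normal_cdf_def cdf_def2
    by (intro std_normal_measure_le) (auto intro: mult_nonpos_nonpos)
  then show ?thesis by (simp add: normal_min_tail_def)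
next
  case False
  then have "1 - std_normal_cdf x \<le> exp (- x\<^sup>2 / 2)"
    unfolding std_normal_cdf_complement
    by (intro std_normal_measure_le) auto
  then show ?thesis by (simp add: normal_min_tail_def)
qed

lemma normal_min_tail_ge: "exp (- 1) / sqrt (2 * pi) * exp (- x\<^sup>2) \<le> normal_min_tail x"
  unfolding normal_min_tail_def std_normal_cdf_complement
  unfolding std_normal_cdf_def cdf_def2
  \<comment> \<open>The lower tail contains the unit interval ending at \<open>x\<close>, the upper
    tail the one starting there.\<close>
  by (intro min.boundedI std_normal_measure_ge[where a = "x - 1"] std_normal_measure_ge[where a = x])
    auto

lemma normal_min_tail_pos: "0 < normal_min_tail x"
  by (rule less_le_trans[OF _ normal_min_tail_ge]) simp

text \<open>\<open>inv\<close> returns some preimage whenever one exists, so it is enough to find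
  \<open>p\<close> in the range. The law has no atoms, hence the cdf is continuous; it tends to 0
  and 1 at the two ends, and the intermediate value theorem applies.\<close>

lemma std_normal_cdf_inv:
  assumes "0 < p" "p < 1"
  shows "std_normal_cdf (inv std_normal_cdf p) = p"
proof -
  interpret real_distribution std_normal_distribution
    by (rule real_dist_normal_dist)
  have "isCont std_normal_cdf x" for x
  proof -
    have "AE t in lborel. t \<noteq> x" by (rule AE_lborel_singleton)
    then have "AE t in std_normal_distribution. t \<noteq> x"
      by (subst AE_density) auto
    then have "measure std_normal_distribution {x} = 0"
      by (subst prob_eq_0) auto
    then show ?thesis by (simp add: std_normal_cdf_def isCont_cdf)
  qed
  moreover obtain a where a: "std_normal_cdf a < p"
    using order_tendstoD(2)[OF cdf_lim_at_bot \<open>0 < p\<close>]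
    by (auto simp: std_normal_cdf_def eventually_at_bot_linorder)
  moreover obtain b where b: "p < std_normal_cdf b"
    using order_tendstoD(1)[OF cdf_lim_at_top_prob \<open>p < 1\<close>]
    by (auto simp: std_normal_cdf_def eventually_at_top_linorder)
  moreover have "a \<le> b"
    using a b cdf_nondecreasing[of b a] by (force simp: std_normal_cdf_def)
  ultimately obtain x where "std_normal_cdf x = p"
    using IVT[of std_normal_cdf a p b] by auto
  then show ?thesis
    by (metis f_inv_into_f rangeI)
qed

section \<open>Effect of a bounded displacement on the smaller tail\<close>

lemma square_le_of_dist_le:
  fixes y z D :: real
  assumes "\<bar>y - z\<bar> \<le> D"
  shows "y\<^sup>2 \<le> 2 * z\<^sup>2 + 2 * D\<^sup>2"
proof -
  have "(y - z)\<^sup>2 \<le> D\<^sup>2"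
    using power_mono[OF assms, of 2] by simp
  moreover have "2 * z\<^sup>2 + 2 * (y - z)\<^sup>2 - y\<^sup>2 = (2 * z - y)\<^sup>2"
    by (simp add: power2_eq_square algebra_simps)
  then have "y\<^sup>2 \<le> 2 * z\<^sup>2 + 2 * (y - z)\<^sup>2"
    by (metis diff_ge_0_iff_ge zero_le_power2)
  ultimately show ?thesis by linarith
qed

lemma normal_min_tail_perturb:
  assumes "\<bar>y - z\<bar> \<le> D"
  shows "exp (- 1 - 2 * D\<^sup>2) / sqrt (2 * pi) * normal_min_tail z ^ 4 \<le> normal_min_tail y"
proof -
  \<comment> \<open>The exponent 4 turns the decay rate 1/2 of the upper tail bound into the rate 2
    that \<open>square_le_of_dist_le\<close> requires.\<close>
  have "normal_min_tail z ^ 4 \<le> exp (- z\<^sup>2 / 2) ^ 4"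
    using normal_min_tail_le[of z] normal_min_tail_pos[of z] by (intro power_mono) auto
  also have "\<dots> = exp (- 2 * z\<^sup>2)"
    by (simp add: exp_of_nat_mult[symmetric])
  finally have "exp (- 1 - 2 * D\<^sup>2) / sqrt (2 * pi) * normal_min_tail z ^ 4
      \<le> exp (- 1 - 2 * D\<^sup>2) / sqrt (2 * pi) * exp (- 2 * z\<^sup>2)"
    by (intro mult_left_mono) auto
  also have "\<dots> = exp (- 1) / sqrt (2 * pi) * exp (- (2 * z\<^sup>2 + 2 * D\<^sup>2))"
    by (simp add: exp_add[symmetric])
  also have "\<dots> \<le> exp (- 1) / sqrt (2 * pi) * exp (- y\<^sup>2)"
    using square_le_of_dist_le[OF assms] by (intro mult_left_mono) auto
  also have "\<dots> \<le> normal_min_tail y"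
    by (rule normal_min_tail_ge)
  finally show ?thesis .
qed

text \<open>Logarithms in \<open>normal_min_tail_ge\<close> give the bound
  \<open>z^2 + 1 + ln (sqrt (2 * pi))\<close> on the absolute logarithm. Then
  \<open>square_le_of_dist_le\<close> with \<open>y\<close> and \<open>z\<close> exchanged, followed
  by halving, yields the constants.\<close>

lemma square_ge_ln_normal_min_tail:
  assumes "\<bar>y - z\<bar> \<le> D"
  shows "\<bar>ln (normal_min_tail z)\<bar> / 2 - (D\<^sup>2 + (1 + ln (sqrt (2 * pi))) / 2) \<le> y\<^sup>2"
proof -
  have "normal_min_tail z \<le> 1"
    using normal_min_tail_le[of z] by (rule order_trans) simp
  then have "\<bar>ln (normal_min_tail z)\<bar> = - ln (normal_min_tail z)"
    using normal_min_tail_pos[of z] by simp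
  moreover have "- 1 - ln (sqrt (2 * pi)) - z\<^sup>2 \<le> ln (normal_min_tail z)"
  proof -
    have "- 1 - ln (sqrt (2 * pi)) - z\<^sup>2 = ln (exp (- 1) / sqrt (2 * pi) * exp (- z\<^sup>2))"
      by (subst ln_mult) (auto simp: ln_div)
    also have "\<dots> \<le> ln (normal_min_tail z)"
      using normal_min_tail_ge[of z] normal_min_tail_pos[of z] by (subst ln_le_cancel_iff) auto
    finally show ?thesis .
  qed
  moreover have "z\<^sup>2 \<le> 2 * y\<^sup>2 + 2 * D\<^sup>2"
    using assms by (intro square_le_of_dist_le) (simp add: abs_minus_commute)
  ultimately show ?thesis by (simp add: field_simps)
qed

section \<open>Displacement by the Euler steps\<close>

text \<open>A \<open>step\<close> would leave a positive entry at its coordinate, so only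
  \<open>zero\<close> can derive the zero index. This turns the order-zero assumption into a bound
  on the field itself.\<close>

lemma mixed_partial_zeroD:
  assumes "mixed_partial F (\<lambda>_. 0) H"
  shows "H = F"
  using assms
proof cases
  case (step \<beta> H' i)
  then have "(\<lambda>_. 0 :: nat) i = (\<beta>(i := Suc (\<beta> i))) i" by metis
  then show ?thesis by simp
qed simp

text \<open>Each step adds at most the step length times \<open>M\<close>. The restriction
  \<open>n \<le> K\<close> keeps the step times inside \<open>{0..T}\<close>, where the field is
  bounded.\<close>

lemma euler_flow_displacement:
  fixes v :: "real ^ 'n \<Rightarrow> real \<Rightarrow> real ^ 'n"
  assumes "T > 0"
    and v: "\<And>x t j. t \<in> {0..T} \<Longrightarrow> \<bar>v x t $ j\<bar> \<le> M"
  shows "n \<le> K \<Longrightarrow> \<bar>euler_flow v T K n z $ j - z $ j\<bar> \<le> real n * (T / real K * M)"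
proof (induction n)
  case 0
  then show ?case by simp
next
  case (Suc n)
  define x where "x = euler_flow v T K n z"
  define t where "t = T - real n * (T / real K)"
  have "real n * (T / real K) \<le> T"
    using Suc.prems \<open>T > 0\<close> by (simp add: field_simps)
  then have "t \<in> {0..T}"
    using \<open>T > 0\<close> by (simp add: t_def)
  then have "\<bar>v x t $ j\<bar> \<le> M" by (rule v)
  then have "\<bar>T / real K * v x t $ j\<bar> \<le> T / real K * M"
    using \<open>T > 0\<close> unfolding abs_mult by (intro mult_mono) auto
  moreover have "euler_flow v T K (Suc n) z $ j = x $ j - T / real K * v x t $ j"
    by (simp add: euler_step_def Let_def x_def t_def)
  moreover have "\<bar>x $ j - z $ j\<bar> \<le> real n * (T / real K * M)"
    using Suc by (simp add: x_def)
  moreover have "real (Suc n) * (T / real K * M) = real n * (T / real K * M) + T / real K * M"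
    by (simp only: of_nat_Suc distrib_right)
  ultimately show ?case by linarith
qed

lemma le_prod_of_ge_one:
  fixes h :: "'a \<Rightarrow> real"
  assumes "finite A" "k \<in> A" "\<And>l. l \<in> A \<Longrightarrow> 1 \<le> h l"
  shows "h k \<le> prod h A"
proof -
  have "h k * 1 \<le> h k * prod h (A - {k})"
    using assms by (intro mult_left_mono prod_ge_1) (auto intro: order_trans[of 0 1])
  then show ?thesis
    using assms by (simp add: prod.remove)
qed

theorem theorem5p5:
  fixes f s v :: "real ^ 'n \<Rightarrow> real \<Rightarrow> real ^ 'n"
    and g :: "real \<Rightarrow> real"
    and T :: real and K :: nat
    and \<tau> :: "real ^ 'n \<Rightarrow> real ^ 'n"
  defines "v \<equiv> diffusion_field f g s"
    and "\<tau> \<equiv> euler_transport v T K"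
  assumes "T > 0" and "K \<ge> 1"
    and bounds: "\<And>\<beta> :: 'n \<Rightarrow> nat. (\<Sum>i\<in>UNIV. \<beta> i) \<le> CARD('n) + 1 \<Longrightarrow>
      \<exists>M. \<forall>j. \<forall>t\<in>{0..T}. \<exists>H. mixed_partial (\<lambda>x. v x t $ j) \<beta> H \<and> (\<forall>x. \<bar>H x\<bar> \<le> M)"
  shows "(\<exists>B\<^sub>0>0. \<exists>C\<^sub>4>0. \<forall>u\<in>box 0 1. \<forall>k.
        inverse (min (std_normal_cdf (\<tau> u $ k)) (1 - std_normal_cdf (\<tau> u $ k)))
          \<le> C\<^sub>4 * (\<Prod>l\<in>UNIV. min (u $ l) (1 - u $ l) powr (- B\<^sub>0)))
    \<and> (\<exists>C\<^sub>5>0. \<exists>C' :: real. \<forall>u\<in>box 0 1. \<forall>k.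
        \<bar>\<tau> u $ k\<bar>\<^sup>2 \<ge> C\<^sub>5 * \<bar>ln (min (u $ k) (1 - u $ k))\<bar> - C')"
proof -
  \<comment> \<open>\<open>M\<close> comes before \<open>j\<close> and \<open>t\<close>, so one
    bound serves all coordinates and all step times.\<close>
  obtain M where M: "\<forall>j. \<forall>t\<in>{0..T}. \<exists>H. mixed_partial (\<lambda>x. v x t $ j) (\<lambda>_. 0) H \<and> (\<forall>x. \<bar>H x\<bar> \<le> M)"
    using bounds[of "\<lambda>_. 0"] by auto
  have v: "\<bar>v x t $ j\<bar> \<le> M" if "t \<in> {0..T}" for x t j
    using M that by (metis mixed_partial_zeroD)
  define D where "D = real K * (T / real K * M)"
  define z where "z u = normal_quantile_map u" for u :: "real ^ 'n"
  have disp: "\<bar>\<tau> u $ k - z u $ k\<bar> \<le> D" for u k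
    using euler_flow_displacement[OF \<open>T > 0\<close> v order_refl, where K = K]
    by (simp add: \<tau>_def euler_transport_def z_def D_def)
  have u01: "0 < u $ l" "u $ l < 1" if "u \<in> box 0 1" for u :: "real ^ 'n" and l
    using that by (auto simp: mem_box_cart)
  \<comment> \<open>The quantile map turns the smaller tail at \<open>z u\<close> into the
    expression in \<open>u\<close> that both claims use.\<close>
  have tail: "normal_min_tail (z u $ l) = min (u $ l) (1 - u $ l)" if "u \<in> box 0 1" for u l
    using u01[OF that] by (simp add: normal_min_tail_def z_def normal_quantile_map_def std_normal_cdf_inv)
  define c where "c = exp (- 1 - 2 * D\<^sup>2) / sqrt (2 * pi)"
  have c: "0 < c" by (simp add: c_def)
  have first: "inverse (normal_min_tail (\<tau> u $ k))
      \<le> inverse c * (\<Prod>l\<in>UNIV. min (u $ l) (1 - u $ l) powr (- 4))"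
    if u: "u \<in> box 0 1" for u k
  proof -
    let ?m = "\<lambda>l. min (u $ l) (1 - u $ l)"
    have m: "0 < ?m l" "?m l \<le> 1" for l
      using u01[OF u] by (auto simp: min_def)
    have "c * ?m k ^ 4 \<le> normal_min_tail (\<tau> u $ k)"
      using normal_min_tail_perturb[OF disp] unfolding c_def tail[OF u, symmetric] .
    then have "inverse (normal_min_tail (\<tau> u $ k)) \<le> inverse (c * ?m k ^ 4)"
      using c m[of k] by (intro le_imp_inverse_le) auto
    also have "\<dots> = inverse c * ?m k powr (- 4)"
      using m[of k] by (simp add: powr_minus)
    \<comment> \<open>Since \<open>?m l\<close> lies in (0,1], its negative power is at least 1, so
      the other coordinates can be multiplied in.\<close>
    also have "\<dots> \<le> inverse c * (\<Prod>l\<in>UNIV. ?m l powr (- 4))"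
    proof (rule mult_left_mono)
      have "1 \<le> ?m l powr (- 4)" for l
        using m[of l] by (auto simp: powr_minus intro!: one_le_inverse power_le_one)
      then show "?m k powr (- 4) \<le> (\<Prod>l\<in>UNIV. ?m l powr (- 4))"
        by (intro le_prod_of_ge_one) auto
    qed (use c in simp)
    finally show ?thesis .
  qed
  have second: "\<bar>\<tau> u $ k\<bar>\<^sup>2 \<ge> 1 / 2 * \<bar>ln (min (u $ k) (1 - u $ k))\<bar>
      - (D\<^sup>2 + (1 + ln (sqrt (2 * pi))) / 2)" if u: "u \<in> box 0 1" for u k
    using square_ge_ln_normal_min_tail[OF disp[of u k]] by (simp add: tail[OF u])
  show ?thesis
  proof
    show "\<exists>B\<^sub>0>0. \<exists>C\<^sub>4>0. \<forall>u\<in>box 0 1. \<forall>k.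
        inverse (min (std_normal_cdf (\<tau> u $ k)) (1 - std_normal_cdf (\<tau> u $ k)))
          \<le> C\<^sub>4 * (\<Prod>l\<in>UNIV. min (u $ l) (1 - u $ l) powr (- B\<^sub>0))"
      \<comment> \<open>\<open>B\<^sub>0 = 4\<close> is the power lost in
        \<open>normal_min_tail_perturb\<close>; \<open>inverse c\<close> inverts its
        constant.\<close>
      by (rule exI[of _ 4], rule conjI, simp, rule exI[of _ "inverse c"])
        (use c first in \<open>auto simp: normal_min_tail_def\<close>)
    show "\<exists>C\<^sub>5>0. \<exists>C' :: real. \<forall>u\<in>box 0 1. \<forall>k.
        \<bar>\<tau> u $ k\<bar>\<^sup>2 \<ge> C\<^sub>5 * \<bar>ln (min (u $ k) (1 - u $ k))\<bar> - C'"
      using second by (intro exI[of _ "1/2"] exI[of _ "D\<^sup>2 + (1 + ln (sqrt (2 * pi))) / 2"]) auto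
  qed
qed

end
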